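(* Let $T$ be a group that does not admit a uniform automorphism, let $k\geq 2$ be an integer, and let $X$ and $Y$ be subgroups of $T^k$ each of which is a direct product of pairwise disjoint non-trivial full strips in $T^k$. Then $XY\neq T^k$.
   Context: Groups may be infinite. Maps act on the right. For subsets $X,Y$ of a group, $XY=\{xy\mid x\in X,\ y\in Y\}$. An automorphism $\alpha$ of a group $G$ is uniform if the map $G\to G$, $g\mapsto g^{-1}(g\alpha)$ is surjective. Let $G=G_1\times\cdots\times G_k$ be a direct product of groups with coordinate projections $\sigma_i:G\to G_i$. A strip in $G$ is a subgroup $H$ for which there exist indices $1\leq i_1<\cdots<i_m\leq k$, a subgroup $H_0\leq G_{i_1}$ and injective homomorphisms $\alpha_j:H_0\to G_{i_j}$ for $2\leq j\leq m$ such that $$H=\{(g_1,\ldots,g_k)\mid g_{i_1}\in H_0,\ g_{i_j}=g_{i_1}\alpha_j \text{ for } 2\leq j\leq m,\text{ and } g_i=1 \text{ if } i\notin\{i_1,\ldots,i_m\}\}.$$ The set $\mathrm{Supp}\,H=\{G_{i_1},\ldots,G_{i_m}\}$ (regarded as a set of direct factors, distinct for distinct indices) is the support of $H$. The strip $H$ is non-trivial if $|\mathrm{Supp}\,H|\geq 2$, and full if $H\sigma_i=G_i$ whenever $G_i\in\mathrm{Supp}\,H$. Two strips are disjoint if their supports are disjoint. Here these notions are applied with $G_1=\cdots=G_k=T$. *)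

theory Defs
  imports "HOL-Algebra.Product_Groups" "HOL-Algebra.Generated_Groups" "HOL-Algebra.Bij"
    "HOL-Library.Disjoint_Sets"
begin

definition uniform_automorphism :: "('a, 'b) monoid_scheme \<Rightarrow> ('a \<Rightarrow> 'a) \<Rightarrow> bool" where
  "uniform_automorphism T \<alpha> \<longleftrightarrow>
     \<alpha> \<in> auto T \<and> (\<lambda>g. inv\<^bsub>T\<^esub> g \<otimes>\<^bsub>T\<^esub> \<alpha> g) ` carrier T = carrier T"

text \<open>
  The direct product of \<open>G 1, \<dots>, G k\<close> is \<open>product_group {1..k} G\<close>. The
  predicate below says that \<open>H\<close> is a strip with support \<open>S\<close>, the support being recorded
  as a set of indices. It is a relation because the trivial subgroup arises (with \<open>H0\<close>
  trivial) from every choice of indices; every other strip determines its support. The values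
  \<open>\<alpha> j\<close> are only used for \<open>2 \<le> j \<le> m\<close>.
\<close>

definition strip_with_support ::
    "nat \<Rightarrow> (nat \<Rightarrow> ('a, 'b) monoid_scheme) \<Rightarrow> (nat \<Rightarrow> 'a) set \<Rightarrow> nat set \<Rightarrow> bool" where
  "strip_with_support k G H S \<longleftrightarrow>
     subgroup H (product_group {1..k} G) \<and>
     (\<exists>(m::nat) (i :: nat \<Rightarrow> nat) H0 \<alpha>.
        1 \<le> m \<and> strict_mono_on {1..m} i \<and> i ` {1..m} \<subseteq> {1..k} \<and> S = i ` {1..m} \<and>
        subgroup H0 (G (i 1)) \<and>
        (\<forall>j\<in>{2..m}. \<alpha> j \<in> hom ((G (i 1))\<lparr>carrier := H0\<rparr>) (G (i j)) \<and> inj_on (\<alpha> j) H0) \<and>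
        H = {g \<in> carrier (product_group {1..k} G).
               g (i 1) \<in> H0 \<and>
               (\<forall>j\<in>{2..m}. g (i j) = \<alpha> j (g (i 1))) \<and>
               (\<forall>l\<in>{1..k} - i ` {1..m}. g l = \<one>\<^bsub>G l\<^esub>)})"

definition nontrivial_full_strip ::
    "nat \<Rightarrow> (nat \<Rightarrow> ('a, 'b) monoid_scheme) \<Rightarrow> (nat \<Rightarrow> 'a) set \<Rightarrow> nat set \<Rightarrow> bool" where
  "nontrivial_full_strip k G H S \<longleftrightarrow>
     strip_with_support k G H S \<and> card S \<ge> 2 \<and> (\<forall>i\<in>S. (\<lambda>g. g i) ` H = carrier (G i))"

definition internal_direct_product ::
    "('a, 'b) monoid_scheme \<Rightarrow> 'i set \<Rightarrow> ('i \<Rightarrow> 'a set) \<Rightarrow> 'a set \<Rightarrow> bool" where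
  "internal_direct_product G I H X \<longleftrightarrow>
     subgroup X G \<and>
     (\<forall>j\<in>I. H j \<lhd> G\<lparr>carrier := X\<rparr>) \<and>
     X = generate G (\<Union>j\<in>I. H j) \<and>
     (\<forall>j\<in>I. H j \<inter> generate G (\<Union>l\<in>I - {j}. H l) = {\<one>\<^bsub>G\<^esub>})"

text \<open>The number \<open>r\<close> of strips may be \<open>0\<close>; the empty direct product is the trivial subgroup.\<close>

definition product_of_disjoint_nontrivial_full_strips ::
    "nat \<Rightarrow> (nat \<Rightarrow> ('a, 'b) monoid_scheme) \<Rightarrow> (nat \<Rightarrow> 'a) set \<Rightarrow> bool" where
  "product_of_disjoint_nontrivial_full_strips k G X \<longleftrightarrow>
     (\<exists>(r::nat) H S.
        (\<forall>j\<in>{1..r}. nontrivial_full_strip k G (H j) (S j)) \<and>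
        disjoint_family_on S {1..r} \<and>
        internal_direct_product (product_group {1..k} G) {1..r} H X)"

end

theory Submission imports Defs begin

text \<open>
  Suppose \<open>X Y = T\<^sup>k\<close>; a uniform automorphism of \<open>T\<close> is constructed. Call two coordinates linked in a
  set of tuples if a single automorphism of \<open>T\<close> computes one coordinate from the other on the whole
  set. Two coordinates in the support of the same strip of \<open>X\<close> are linked in \<open>X\<close>, because a full
  strip is the graph of automorphisms of \<open>T\<close> and because the other strips are trivial at both
  coordinates (\<open>disjoint_strips_linked_or_trivial\<close>). So each coordinate is either linked in \<open>X\<close> to
  another one, since strips are non-trivial, or constantly \<open>1\<close> on \<open>X\<close>; likewise for \<open>Y\<close>.

  Assume first that no coordinate is of the second kind. The classes of coordinates linked in \<open>X\<close>
  and those linked in \<open>Y\<close> are the vertices of a bipartite multigraph whose edges are the coordinates.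
  All degrees are at least two, so there is a cycle, that is, a cyclic sequence of coordinates linked
  alternately in \<open>X\<close> and in \<open>Y\<close> (\<open>alternating_cycle\<close>). Let \<open>c\<close> be a coordinate on the cycle. Given
  \<open>t \<in> T\<close>, write the tuple with entry \<open>t\<close> at \<open>c\<close> and \<open>1\<close> elsewhere as \<open>x y\<inverse>\<close>. Away from \<open>c\<close> the
  tuples \<open>x\<close> and \<open>y\<close> agree, so travelling round the cycle expresses one of \<open>x\<^sub>c\<close> and \<open>y\<^sub>c\<close> as the
  image of the other under an automorphism \<open>\<gamma>\<close> that does not depend on \<open>t\<close>. Since
  \<open>t = x\<^sub>c y\<^sub>c\<inverse>\<close> is arbitrary, \<open>\<gamma>\<close> or its inverse is uniform
  (\<open>uniform_automorphism_of_linked_factorization\<close>).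

  Coordinates that are constantly \<open>1\<close> on \<open>X\<close> or on \<open>Y\<close> are dealt with by taking two copies of
  everything: in \<open>X \<times> X \<subseteq> T\<^sup>k \<times> T\<^sup>k\<close> such a coordinate is linked to its copy by the identity, and
  \<open>(X \<times> X)(Y \<times> Y) = T\<^sup>k \<times> T\<^sup>k\<close> still holds.
\<close>

section \<open>Alternating cycles of two equivalence relations\<close>

text \<open>
  Walk along a bipartite multigraph without ever going straight back along the same edge, until a
  vertex is met for the second time. Here the edges are the elements of \<open>J\<close>, the vertices are the
  classes of \<open>L True\<close> and \<open>L False\<close>, and the walk traverses \<open>e 0, e 1, \<dots>\<close>: the \<open>n\<close>-th vertex is the
  class of \<open>e n\<close> under \<open>L (even n)\<close>, and \<open>e n\<close> leads from the \<open>n\<close>-th vertex to the next one. If the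
  \<open>b\<close>-th vertex is the first to be an old one, the \<open>a\<close>-th, then \<open>e a\<close> is not used again in between:
  this would repeat one of the two ends of \<open>e a\<close> before step \<open>b\<close>.
\<close>

lemma alternating_cycle:
  fixes L :: "bool \<Rightarrow> 'j \<Rightarrow> 'j \<Rightarrow> bool"
  assumes fin: "finite J" and ne: "J \<noteq> {}"
    and refl: "\<And>p i. i \<in> J \<Longrightarrow> L p i i"
    and sym: "\<And>p i j. i \<in> J \<Longrightarrow> j \<in> J \<Longrightarrow> L p i j \<Longrightarrow> L p j i"
    and partner: "\<And>p i. i \<in> J \<Longrightarrow> \<exists>j\<in>J. j \<noteq> i \<and> L p i j"
  obtains e :: "nat \<Rightarrow> 'j" and a b :: nat
  where "a < b" and "even a = even b" and "range e \<subseteq> J"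
    and "\<And>n. L (even (Suc n)) (e n) (e (Suc n))"
    and "L (even b) (e b) (e a)"
    and "\<And>n. a < n \<Longrightarrow> n < b \<Longrightarrow> e n \<noteq> e a"
proof -
  have "\<forall>p. \<forall>i\<in>J. \<exists>j. j \<in> J \<and> j \<noteq> i \<and> L p i j" using partner by blast
  then obtain f where f: "\<And>p i. i \<in> J \<Longrightarrow> f p i \<in> J \<and> f p i \<noteq> i \<and> L p i (f p i)"
    by metis
  obtain i0 where i0: "i0 \<in> J" using ne by blast
  define e where "e = rec_nat i0 (\<lambda>n i. f (even (Suc n)) i)"
  have e_Suc: "e (Suc n) = f (even (Suc n)) (e n)" for n
    by (simp add: e_def)
  have eJ: "e n \<in> J" for n
    by (induction n) (use i0 f in \<open>auto simp: e_def\<close>)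
  have step: "L (even (Suc n)) (e n) (e (Suc n))" and moves: "e (Suc n) \<noteq> e n" for n
    using f[OF eJ] by (simp_all add: e_Suc del: even_Suc)
  define repeats where "repeats a b \<longleftrightarrow> a < b \<and> even a = even b \<and> L (even b) (e b) (e a)" for a b
  have "\<exists>b a. repeats a b"
  proof -
    have "\<not> inj (\<lambda>n. (even n, e n))"
    proof
      assume "inj (\<lambda>n. (even n, e n))"
      moreover have "finite (range (\<lambda>n. (even n, e n)))"
        by (rule finite_subset[of _ "UNIV \<times> J"]) (use eJ fin in auto)
      ultimately show False
        using finite_imageD infinite_UNIV_nat by blast
    qed
    then obtain m n where "m \<noteq> n" "even m = even n" "e m = e n"
      by (auto simp: inj_def)
    then have "repeats (min m n) (max m n)"
      using refl[OF eJ] by (auto simp: repeats_def min_def max_def)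
    then show ?thesis by blast
  qed
  define b where "b = (LEAST b. \<exists>a. repeats a b)"
  obtain a where ab: "repeats a b"
    using LeastI_ex[OF \<open>\<exists>b a. repeats a b\<close>] unfolding b_def by blast
  have first: "\<not> repeats a b'" if "b' < b" for b' a
    using not_less_Least[OF that[unfolded b_def]] by blast
  have "e n \<noteq> e a" if "a < n" "n < b" for n
  proof
    assume eq: "e n = e a"
    show False
    proof (cases "even n = even a")
      case True
      then have "repeats a n"
        using that eq refl[OF eJ] by (simp add: repeats_def)
      then show False using first that by blast
    next
      case False
      \<comment> \<open>Now \<open>e a\<close> is traversed backwards at step \<open>n\<close>, from its end point, which is vertex \<open>a + 1\<close>.\<close>
      then have par: "even n = even (Suc a)" by simp
      have "n \<noteq> Suc a" using eq moves[of a] by auto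
      then have "Suc a < n" using that by simp
      moreover have "L (even n) (e n) (e (Suc a))"
        using step[of a] unfolding eq par .
      ultimately have "repeats (Suc a) n"
        using par by (simp add: repeats_def)
      then show False using first that by blast
    qed
  qed
  then show thesis
    using that[of a b e] ab eJ step by (auto simp: repeats_def)
qed

section \<open>Linked coordinates\<close>

definition linked :: "('a, 'b) monoid_scheme \<Rightarrow> ('j \<Rightarrow> 'a) set \<Rightarrow> 'j \<Rightarrow> 'j \<Rightarrow> bool" where
  "linked T W i j \<longleftrightarrow> (\<exists>\<phi>\<in>iso T T. \<forall>w\<in>W. w j = \<phi> (w i))"

lemma linkedI: "\<phi> \<in> iso T T \<Longrightarrow> (\<And>w. w \<in> W \<Longrightarrow> w j = \<phi> (w i)) \<Longrightarrow> linked T W i j"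
  by (auto simp: linked_def)

lemma linkedE:
  assumes "linked T W i j"
  obtains \<phi> where "\<phi> \<in> iso T T" and "\<And>w. w \<in> W \<Longrightarrow> w j = \<phi> (w i)"
  using assms by (auto simp: linked_def)

lemma linked_refl: "linked T W i i"
  by (rule linkedI[OF iso_set_refl]) simp

lemma linked_sym:
  assumes "group T" "linked T W i j" "\<And>w. w \<in> W \<Longrightarrow> w i \<in> carrier T"
  shows "linked T W j i"
  using assms(2)
proof (rule linkedE)
  fix \<phi> assume \<phi>: "\<phi> \<in> iso T T" "\<And>w. w \<in> W \<Longrightarrow> w j = \<phi> (w i)"
  show ?thesis
  proof (rule linkedI)
    show "inv_into (carrier T) \<phi> \<in> iso T T"
      by (rule group.iso_set_sym[OF assms(1) \<phi>(1)])
    show "w i = inv_into (carrier T) \<phi> (w j)" if "w \<in> W" for w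
      using \<phi>(1) assms(3)[OF that] unfolding \<phi>(2)[OF that]
      by (auto simp: iso_def bij_betw_def)
  qed
qed

lemma linked_trans:
  assumes "linked T W i j" "linked T W j l"
  shows "linked T W i l"
proof -
  obtain \<phi> \<psi> where \<phi>: "\<phi> \<in> iso T T" "\<And>w. w \<in> W \<Longrightarrow> w j = \<phi> (w i)"
    and \<psi>: "\<psi> \<in> iso T T" "\<And>w. w \<in> W \<Longrightarrow> w l = \<psi> (w j)"
    using assms by (metis linkedE)
  show ?thesis
    by (rule linkedI[OF iso_set_trans[OF \<phi>(1) \<psi>(1)]]) (simp add: \<phi>(2) \<psi>(2))
qed

lemma linked_generate:
  assumes T: "group T" and W: "W \<subseteq> carrier (product_group I (\<lambda>_. T))"
    and ij: "i \<in> I" "j \<in> I" and lnk: "linked T W i j"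
  shows "linked T (generate (product_group I (\<lambda>_. T)) W) i j"
  using lnk
proof (rule linkedE)
  let ?P = "product_group I (\<lambda>_. T)"
  fix \<phi> assume \<phi>: "\<phi> \<in> iso T T" "\<And>w. w \<in> W \<Longrightarrow> w j = \<phi> (w i)"
  interpret T: group T by fact
  interpret P: group ?P using T by simp
  interpret \<phi>: group_hom T T \<phi>
    using \<phi>(1) by unfold_locales (simp add: iso_def)
  show ?thesis
  proof (rule linkedI[OF \<phi>(1)])
    fix w assume "w \<in> generate ?P W"
    then show "w j = \<phi> (w i)"
    proof induction
      case one
      then show ?case using ij by simp
    next
      case (incl h)
      then show ?case by (rule \<phi>(2))
    next
      case (inv h)
      have h: "h \<in> (\<Pi>\<^sub>E i\<in>I. carrier T)" using inv W by auto
      then have "h i \<in> carrier T" using ij by auto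
      then show ?case using inv ij T h by (simp add: \<phi>(2))
    next
      case (eng h1 h2)
      have "h1 \<in> carrier ?P" "h2 \<in> carrier ?P"
        using eng W P.generate_in_carrier by blast+
      then have "h1 i \<in> carrier T" "h2 i \<in> carrier T" using ij by auto
      then show ?case using eng ij by simp
    qed
  qed
qed

section \<open>From linked factors to a uniform automorphism\<close>

lemma uniform_automorphism_restrict:
  assumes "group T" "\<gamma> \<in> iso T T"
    and surj: "\<And>t. t \<in> carrier T \<Longrightarrow> \<exists>g\<in>carrier T. inv\<^bsub>T\<^esub> g \<otimes>\<^bsub>T\<^esub> \<gamma> g = t"
  shows "uniform_automorphism T (restrict \<gamma> (carrier T))"
proof -
  interpret T: group T by fact
  have \<gamma>: "\<gamma> \<in> hom T T" "bij_betw \<gamma> (carrier T) (carrier T)"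
    using assms(2) by (auto simp: iso_def)
  have "restrict \<gamma> (carrier T) \<in> hom T T"
    using \<gamma>(1) by (auto simp: hom_def Pi_iff)
  moreover have "restrict \<gamma> (carrier T) \<in> Bij (carrier T)"
    using \<gamma>(2) by (simp add: Bij_def bij_betw_restrict_eq)
  moreover have "(\<lambda>g. inv\<^bsub>T\<^esub> g \<otimes>\<^bsub>T\<^esub> restrict \<gamma> (carrier T) g) ` carrier T = carrier T"
  proof
    show "(\<lambda>g. inv\<^bsub>T\<^esub> g \<otimes>\<^bsub>T\<^esub> restrict \<gamma> (carrier T) g) ` carrier T \<subseteq> carrier T"
      using \<gamma>(1) by (auto simp: hom_def Pi_iff)
    show "carrier T \<subseteq> (\<lambda>g. inv\<^bsub>T\<^esub> g \<otimes>\<^bsub>T\<^esub> restrict \<gamma> (carrier T) g) ` carrier T"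
    proof
      fix t assume "t \<in> carrier T"
      from surj[OF this] obtain g where "g \<in> carrier T" "inv\<^bsub>T\<^esub> g \<otimes>\<^bsub>T\<^esub> \<gamma> g = t" by blast
      then show "t \<in> (\<lambda>g. inv\<^bsub>T\<^esub> g \<otimes>\<^bsub>T\<^esub> restrict \<gamma> (carrier T) g) ` carrier T"
        by (intro image_eqI[of _ _ g]) auto
    qed
  qed
  ultimately show ?thesis
    by (simp add: uniform_automorphism_def auto_def)
qed

text \<open>
  The hypothesis \<open>factor\<close> extracts from a factorization of the full power of \<open>T\<close> what the cycle
  argument uses: tuples \<open>w True\<close> and \<open>w False\<close> that agree except at one prescribed coordinate, where
  their quotient is a prescribed element.
\<close>

theorem uniform_automorphism_of_linked_factorization:
  fixes W :: "bool \<Rightarrow> ('j \<Rightarrow> 'a) set"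
  assumes T: "group T" and J: "finite J" "J \<noteq> {}"
    and car: "\<And>p w i. w \<in> W p \<Longrightarrow> i \<in> J \<Longrightarrow> w i \<in> carrier T"
    and partner: "\<And>p i. i \<in> J \<Longrightarrow> \<exists>j\<in>J. j \<noteq> i \<and> linked T (W p) i j"
    and factor: "\<And>c t. c \<in> J \<Longrightarrow> t \<in> carrier T \<Longrightarrow>
      \<exists>w. (\<forall>p. w p \<in> W p) \<and> w True c \<otimes>\<^bsub>T\<^esub> inv\<^bsub>T\<^esub> w False c = t \<and>
          (\<forall>i\<in>J - {c}. w True i = w False i)"
  shows "\<exists>\<alpha>. uniform_automorphism T \<alpha>"
proof -
  interpret T: group T by fact
  obtain e a b where ab: "a < b" "even a = even b" and eJ: "range e \<subseteq> J"
    and step: "\<And>n. linked T (W (even (Suc n))) (e n) (e (Suc n))"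
    and close: "linked T (W (even b)) (e b) (e a)"
    and off: "\<And>n. a < n \<Longrightarrow> n < b \<Longrightarrow> e n \<noteq> e a"
    by (rule alternating_cycle[of J "\<lambda>p. linked T (W p)", OF J linked_refl linked_sym[OF T] partner])
       (auto intro: car)
  define c where "c = e a"
  have c: "c \<in> J" using eJ by (auto simp: c_def)
  define admissible where "admissible w \<longleftrightarrow>
    (\<forall>p. w p \<in> W p) \<and> (\<forall>i\<in>J - {c}. w True i = w False i)" for w
  define q where "q = even (Suc a)"
  \<comment> \<open>Travel round the cycle, starting at \<open>c\<close> in the factor \<open>w q\<close>. Away from \<open>c\<close> the two factors have
      the same values, so a link in one factor can be followed by a link in the other.\<close>
  have chain: "\<exists>\<phi>\<in>iso T T. \<forall>w. admissible w \<longrightarrow> w (even n) (e n) = \<phi> (w q c)"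
    if "Suc a \<le> n" "n \<le> b" for n
    using that
  proof (induction n rule: dec_induct)
    case base
    obtain \<phi> where "\<phi> \<in> iso T T" "\<And>w. w \<in> W q \<Longrightarrow> w (e (Suc a)) = \<phi> (w c)"
      using step[of a] unfolding c_def q_def by (metis linkedE)
    then show ?case
      unfolding admissible_def q_def by blast
  next
    case (step n)
    obtain \<phi> where \<phi>: "\<phi> \<in> iso T T" "\<And>w. admissible w \<Longrightarrow> w (even n) (e n) = \<phi> (w q c)"
      using step by auto
    obtain \<psi> where \<psi>: "\<psi> \<in> iso T T"
      "\<And>w. w \<in> W (even (Suc n)) \<Longrightarrow> w (e (Suc n)) = \<psi> (w (e n))"
      using \<open>\<And>n. linked T (W (even (Suc n))) (e n) (e (Suc n))\<close>[of n] by (metis linkedE)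
    have "w (even (Suc n)) (e (Suc n)) = (\<psi> \<circ> \<phi>) (w q c)" if w: "admissible w" for w
    proof -
      have "e n \<in> J - {c}" using off[of n] step eJ by (auto simp: c_def)
      then have "w True (e n) = w False (e n)" using w by (auto simp: admissible_def)
      then have "w (even (Suc n)) (e n) = w (even n) (e n)" by (cases "even n") auto
      moreover have "w (even (Suc n)) (e (Suc n)) = \<psi> (w (even (Suc n)) (e n))"
        using w by (intro \<psi>(2)) (simp add: admissible_def)
      ultimately show ?thesis using \<phi>(2)[OF w] by (simp del: even_Suc)
    qed
    moreover have "\<psi> \<circ> \<phi> \<in> iso T T" by (rule iso_set_trans[OF \<phi>(1) \<psi>(1)])
    ultimately show ?case by blast
  qed
  obtain \<phi> where \<phi>: "\<phi> \<in> iso T T" "\<And>w. admissible w \<Longrightarrow> w (even b) (e b) = \<phi> (w q c)"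
    using chain[of b] ab by auto
  obtain \<psi> where \<psi>: "\<psi> \<in> iso T T" "\<And>w. w \<in> W (even b) \<Longrightarrow> w c = \<psi> (w (e b))"
    using close unfolding c_def by (metis linkedE)
  define \<gamma> where "\<gamma> = \<psi> \<circ> \<phi>"
  have \<gamma>: "\<gamma> \<in> iso T T" unfolding \<gamma>_def by (rule iso_set_trans[OF \<phi>(1) \<psi>(1)])
  have turn: "w (\<not> q) c = \<gamma> (w q c)" if "admissible w" for w
  proof -
    have "even b = (\<not> q)" using ab by (simp add: q_def)
    then show ?thesis using \<phi>(2)[OF that] \<psi>(2)[of "w (even b)"] that
      by (simp add: \<gamma>_def admissible_def)
  qed
  \<comment> \<open>Depending on the factor in which the cycle leaves \<open>c\<close>, this is \<open>\<gamma>\<close> or its inverse.\<close>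
  obtain \<delta> where \<delta>: "\<delta> \<in> iso T T" "\<And>w. admissible w \<Longrightarrow> w False c = \<delta> (w True c)"
  proof (cases q)
    case True
    then show thesis using that[OF \<gamma>] turn by auto
  next
    case False
    have "w False c = inv_into (carrier T) \<gamma> (w True c)" if "admissible w" for w
    proof -
      have "w True c = \<gamma> (w False c)" using turn[OF that] False by simp
      moreover have "w False c \<in> carrier T"
        using that car[OF _ c] by (auto simp: admissible_def)
      moreover have "inj_on \<gamma> (carrier T)" using \<gamma> by (simp add: iso_def bij_betw_def)
      ultimately show ?thesis by simp
    qed
    then show thesis using that[OF T.iso_set_sym[OF \<gamma>]] by blast
  qed
  interpret \<delta>: group_hom T T \<delta>
    using \<delta>(1) by unfold_locales (simp add: iso_def)
  have "\<exists>g\<in>carrier T. inv\<^bsub>T\<^esub> g \<otimes>\<^bsub>T\<^esub> \<delta> g = t" if "t \<in> carrier T" for t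
  proof -
    obtain w where w: "admissible w" "w True c \<otimes>\<^bsub>T\<^esub> inv\<^bsub>T\<^esub> w False c = t"
      using factor[OF c \<open>t \<in> carrier T\<close>] by (auto simp: admissible_def)
    have "w True c \<in> carrier T" using w(1) c car by (auto simp: admissible_def)
    then show ?thesis using w(2) \<delta>(2)[OF w(1)]
      by (intro bexI[of _ "inv\<^bsub>T\<^esub> w True c"]) auto
  qed
  then show ?thesis using uniform_automorphism_restrict[OF T \<delta>(1)] by blast
qed

section \<open>Products of strips\<close>

lemma nontrivial_full_strip_linked:
  assumes T: "group T" and H: "nontrivial_full_strip k (\<lambda>_. T) H S"
    and ij: "i \<in> S" "j \<in> S"
  shows "linked T H i j"
proof -
  interpret T: group T by fact
  obtain m :: nat and s :: "nat \<Rightarrow> nat" and H0 \<alpha> where m: "1 \<le> m" and S: "S = s ` {1..m}"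
    and H0: "subgroup H0 T"
    and \<alpha>: "\<And>l. l \<in> {2..m} \<Longrightarrow> \<alpha> l \<in> hom (T\<lparr>carrier := H0\<rparr>) T \<and> inj_on (\<alpha> l) H0"
    and Heq: "H = {g \<in> carrier (product_group {1..k} (\<lambda>_. T)). g (s 1) \<in> H0 \<and>
               (\<forall>l\<in>{2..m}. g (s l) = \<alpha> l (g (s 1))) \<and> (\<forall>l\<in>{1..k} - s ` {1..m}. g l = \<one>\<^bsub>T\<^esub>)}"
    using H unfolding nontrivial_full_strip_def strip_with_support_def by blast
  have full: "(\<lambda>g. g l) ` H = carrier T" if "l \<in> S" for l
    using H that by (simp add: nontrivial_full_strip_def)
  have s1: "s 1 \<in> S" using m S by auto
  have "carrier T \<subseteq> H0"
    unfolding full[OF s1, symmetric] by (auto simp: Heq)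
  then have H0T: "H0 = carrier T"
    using subgroup.subset[OF H0] by blast
  have car: "g l \<in> carrier T" if "g \<in> H" "l \<in> S" for g l
    using full[OF that(2)] that(1) by blast
  have first: "linked T H (s 1) l" if "l \<in> S" for l
  proof -
    obtain n where n: "n \<in> {1..m}" "l = s n" using \<open>l \<in> S\<close> S by blast
    show ?thesis
    proof (cases "n = 1")
      case True
      then show ?thesis using n linked_refl by simp
    next
      case False
      then have n2: "n \<in> {2..m}" using n by auto
      have eq: "g l = \<alpha> n (g (s 1))" if "g \<in> H" for g
        using that n2 n(2) by (auto simp: Heq)
      have "\<alpha> n ` carrier T = (\<lambda>g. \<alpha> n (g (s 1))) ` H"
        unfolding full[OF s1, symmetric] by (simp add: image_image)
      also have "\<dots> = carrier T"
        using full[OF \<open>l \<in> S\<close>] eq by (metis (no_types, lifting) image_cong)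
      finally have "\<alpha> n \<in> iso T T"
        using \<alpha>[OF n2] by (simp add: iso_def bij_betw_def H0T)
      then show ?thesis using eq by (rule linkedI)
    qed
  qed
  show ?thesis
    using linked_trans[OF linked_sym[OF T first[OF ij(1)]] first[OF ij(2)]] car s1 by blast
qed

lemma nontrivial_full_strip_outside:
  assumes "nontrivial_full_strip k (\<lambda>_. T) H S" "h \<in> H" "l \<in> {1..k} - S"
  shows "h l = \<one>\<^bsub>T\<^esub>"
  using assms unfolding nontrivial_full_strip_def strip_with_support_def by blast

lemma nontrivial_full_strip_subset:
  assumes "nontrivial_full_strip k (\<lambda>_. T) H S"
  shows "H \<subseteq> carrier (product_group {1..k} (\<lambda>_. T))" "S \<subseteq> {1..k}" "card S \<ge> 2"
  using assms subgroup.subset unfolding nontrivial_full_strip_def strip_with_support_def by blast+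

text \<open>
  The links inside a strip survive in the product: by disjointness all other strips are trivial at
  both coordinates, and an automorphism maps \<open>1\<close> to \<open>1\<close>.
\<close>

lemma disjoint_strips_linked_or_trivial:
  assumes T: "group T" and X: "product_of_disjoint_nontrivial_full_strips k (\<lambda>_. T) X"
    and i: "i \<in> {1..k}"
  shows "(\<exists>j\<in>{1..k}. j \<noteq> i \<and> linked T X i j) \<or> (\<forall>x\<in>X. x i = \<one>\<^bsub>T\<^esub>)"
proof -
  let ?P = "product_group {1..k} (\<lambda>_. T)"
  interpret T: group T by fact
  obtain r :: nat and H S where H: "\<And>l. l \<in> {1..r} \<Longrightarrow> nontrivial_full_strip k (\<lambda>_. T) (H l) (S l)"
    and disj: "disjoint_family_on S {1..r}"
    and dp: "internal_direct_product ?P {1..r} H X"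
    using X unfolding product_of_disjoint_nontrivial_full_strips_def by blast
  let ?U = "\<Union>l\<in>{1..r}. H l"
  have Xeq: "X = generate ?P ?U"
    using dp by (simp add: internal_direct_product_def)
  have U: "?U \<subseteq> carrier ?P"
    using nontrivial_full_strip_subset(1)[OF H] by blast
  show ?thesis
  proof (cases "\<exists>l\<in>{1..r}. i \<in> S l")
    case True
    then obtain l where l: "l \<in> {1..r}" "i \<in> S l" by blast
    have "S l \<noteq> {i}" using nontrivial_full_strip_subset(3)[OF H[OF l(1)]] by auto
    then obtain j where j: "j \<in> S l" "j \<noteq> i" using l(2) by blast
    have jk: "j \<in> {1..k}" using nontrivial_full_strip_subset(2)[OF H[OF l(1)]] j(1) by blast
    obtain \<phi> where \<phi>: "\<phi> \<in> iso T T" "\<And>h. h \<in> H l \<Longrightarrow> h j = \<phi> (h i)"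
      using nontrivial_full_strip_linked[OF T H[OF l(1)] l(2) j(1)] by (metis linkedE)
    interpret \<phi>: group_hom T T \<phi>
      using \<phi>(1) by unfold_locales (simp add: iso_def)
    have "linked T ?U i j"
    proof (rule linkedI[OF \<phi>(1)])
      fix h assume "h \<in> ?U"
      then obtain n where n: "n \<in> {1..r}" "h \<in> H n" by blast
      show "h j = \<phi> (h i)"
      proof (cases "n = l")
        case True
        then show ?thesis using \<phi>(2) n(2) by simp
      next
        case False
        then have "i \<notin> S n" "j \<notin> S n"
          using disjoint_family_onD[OF disj n(1) l(1)] l(2) j(1) by blast+
        then have "h i = \<one>\<^bsub>T\<^esub>" "h j = \<one>\<^bsub>T\<^esub>"
          using nontrivial_full_strip_outside[OF H[OF n(1)] n(2)] i jk by blast+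
        then show ?thesis by simp
      qed
    qed
    then have "linked T X i j"
      unfolding Xeq by (rule linked_generate[OF T U i jk])
    then show ?thesis using j(2) jk by blast
  next
    case False
    have one: "h i = \<one>\<^bsub>T\<^esub>" if "h \<in> ?U" for h
      using that nontrivial_full_strip_outside[OF H] i False by blast
    have "x i = \<one>\<^bsub>T\<^esub>" if "x \<in> generate ?P ?U" for x
      using that
    proof induction
      case one
      then show ?case using i by simp
    next
      case (incl h)
      then show ?case by (rule one)
    next
      case (inv h)
      have "h \<in> (\<Pi>\<^sub>E i\<in>{1..k}. carrier T)" using inv U by auto
      then show ?case using one[OF inv] i T by simp
    next
      case (eng h1 h2)
      then show ?case using i by simp
    qed
    then show ?thesis unfolding Xeq by blast
  qed
qed

section \<open>Two copies\<close>

text \<open>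
  The members of \<open>W \<times> W\<close>, read as tuples with two coordinates \<open>(i, True)\<close> and \<open>(i, False)\<close> for each
  coordinate \<open>i\<close> of \<open>W\<close>.
\<close>

definition two_copies :: "('j \<Rightarrow> 'a) set \<Rightarrow> ('j \<times> bool \<Rightarrow> 'a) set" where
  "two_copies W = {w. \<forall>d. (\<lambda>i. w (i, d)) \<in> W}"

lemma two_copies_linked:
  assumes "(\<exists>j\<in>I. j \<noteq> i \<and> linked T W i j) \<or> (\<forall>w\<in>W. w i = \<one>\<^bsub>T\<^esub>)" "i \<in> I"
  shows "\<exists>j'\<in>I \<times> UNIV. j' \<noteq> (i, d) \<and> linked T (two_copies W) (i, d) j'"
  using assms(1)
proof
  assume "\<exists>j\<in>I. j \<noteq> i \<and> linked T W i j"
  then obtain j \<phi> where j: "j \<in> I" "j \<noteq> i"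
    and \<phi>: "\<phi> \<in> iso T T" "\<And>w. w \<in> W \<Longrightarrow> w j = \<phi> (w i)"
    by (metis linkedE)
  have "linked T (two_copies W) (i, d) (j, d)"
  proof (rule linkedI[OF \<phi>(1)])
    show "w (j, d) = \<phi> (w (i, d))" if "w \<in> two_copies W" for w
      using \<phi>(2)[of "\<lambda>i. w (i, d)"] that unfolding two_copies_def by blast
  qed
  then show ?thesis using j by (intro bexI[of _ "(j, d)"]) auto
next
  assume one: "\<forall>w\<in>W. w i = \<one>\<^bsub>T\<^esub>"
  have "w (i, d') = \<one>\<^bsub>T\<^esub>" if "w \<in> two_copies W" for w d'
    using bspec[OF one, of "\<lambda>i. w (i, d')"] that by (simp add: two_copies_def)
  then have "linked T (two_copies W) (i, d) (i, \<not> d)"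
    by (intro linkedI[OF iso_set_refl]) metis
  then show ?thesis using \<open>i \<in> I\<close> by (intro bexI[of _ "(i, \<not> d)"]) auto
qed

theorem theorem1p2:
  fixes T :: "('a, 'b) monoid_scheme" and k :: nat and X Y :: "(nat \<Rightarrow> 'a) set"
  assumes "group T"
    and "\<not> (\<exists>\<alpha>. uniform_automorphism T \<alpha>)"
    and "k \<ge> 2"
    and "subgroup X (product_group {1..k} (\<lambda>_. T))"
    and "subgroup Y (product_group {1..k} (\<lambda>_. T))"
    and "product_of_disjoint_nontrivial_full_strips k (\<lambda>_. T) X"
    and "product_of_disjoint_nontrivial_full_strips k (\<lambda>_. T) Y"
  shows "X <#>\<^bsub>product_group {1..k} (\<lambda>_. T)\<^esub> Y \<noteq> carrier (product_group {1..k} (\<lambda>_. T))"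
proof
  let ?P = "product_group {1..k} (\<lambda>_. T)"
  assume all: "X <#>\<^bsub>?P\<^esub> Y = carrier ?P"
  interpret T: group T by fact
  interpret X: subgroup X ?P by fact
  interpret Y: subgroup Y ?P by fact
  have carX: "x l \<in> carrier T" if "x \<in> X" "l \<in> {1..k}" for x l
    using X.subset that by (auto dest!: subsetD[OF _ that(1)])
  have carY: "y l \<in> carrier T" if "y \<in> Y" "l \<in> {1..k}" for y l
    using Y.subset that by (auto dest!: subsetD[OF _ that(1)])
  have factor: "\<exists>x\<in>X. \<exists>y\<in>Y. x i \<otimes>\<^bsub>T\<^esub> inv\<^bsub>T\<^esub> y i = t \<and> (\<forall>l\<in>{1..k} - {i}. x l = y l)"
    if i: "i \<in> {1..k}" and t: "t \<in> carrier T" for i t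
  proof -
    have "(\<lambda>l\<in>{1..k}. if l = i then t else \<one>\<^bsub>T\<^esub>) \<in> X <#>\<^bsub>?P\<^esub> Y"
      unfolding all using t by simp
    then obtain x z where x: "x \<in> X" and z: "z \<in> Y"
      and eq: "(\<lambda>l\<in>{1..k}. if l = i then t else \<one>\<^bsub>T\<^esub>) = (\<lambda>l\<in>{1..k}. x l \<otimes>\<^bsub>T\<^esub> z l)"
      by (auto simp: set_mult_def)
    define y where "y = inv\<^bsub>?P\<^esub> z"
    have y: "y \<in> Y" unfolding y_def by (rule Y.m_inv_closed[OF z])
    have "z \<in> (\<Pi>\<^sub>E l\<in>{1..k}. carrier T)" using z Y.subset by auto
    then have yl: "y l = inv\<^bsub>T\<^esub> z l" if "l \<in> {1..k}" for l
      using that by (simp add: y_def)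
    have prod: "x l \<otimes>\<^bsub>T\<^esub> inv\<^bsub>T\<^esub> y l = (if l = i then t else \<one>\<^bsub>T\<^esub>)" if "l \<in> {1..k}" for l
      using fun_cong[OF eq, of l] that yl carY[OF z] by simp
    have "x l = y l" if "l \<in> {1..k} - {i}" for l
    proof -
      have "x l \<otimes>\<^bsub>T\<^esub> inv\<^bsub>T\<^esub> y l = \<one>\<^bsub>T\<^esub>" using prod[of l] that by simp
      then show ?thesis
        using that carX[OF x] carY[OF y] T.inv_equality[of "x l" "inv\<^bsub>T\<^esub> y l"] by simp
    qed
    moreover have "x i \<otimes>\<^bsub>T\<^esub> inv\<^bsub>T\<^esub> y i = t" using prod[OF i] by simp
    ultimately show ?thesis using x y by blast
  qed
  define V where "V p = (if p then X else Y)" for p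
  have "\<exists>\<alpha>. uniform_automorphism T \<alpha>"
  proof (rule uniform_automorphism_of_linked_factorization
      [OF assms(1), of "{1..k} \<times> UNIV" "\<lambda>p. two_copies (V p)"])
    show "finite ({1..k} \<times> (UNIV :: bool set))" "{1..k} \<times> (UNIV :: bool set) \<noteq> {}"
      using assms(3) by auto
    show "w l \<in> carrier T" if w: "w \<in> two_copies (V p)" and l': "l \<in> {1..k} \<times> UNIV" for p w l
    proof -
      obtain i d where l: "l = (i, d)" "i \<in> {1..k}" using l' by auto
      have "(\<lambda>i. w (i, d)) \<in> V p" using w by (simp add: two_copies_def)
      then have "(\<lambda>i. w (i, d)) i \<in> carrier T"
        using carX[OF _ l(2)] carY[OF _ l(2)] by (cases p) (auto simp: V_def)
      then show ?thesis using l by simp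
    qed
    show "\<exists>j\<in>{1..k} \<times> UNIV. j \<noteq> l \<and> linked T (two_copies (V p)) l j" if l: "l \<in> {1..k} \<times> UNIV" for p l
    proof -
      obtain i d where i: "l = (i, d)" "i \<in> {1..k}" using l by auto
      show ?thesis
        unfolding i(1)
        by (rule two_copies_linked[OF _ i(2)], cases p)
          (use disjoint_strips_linked_or_trivial[OF assms(1) _ i(2)] assms(6,7)
           in \<open>simp_all add: V_def\<close>)
    qed
    show "\<exists>w. (\<forall>p. w p \<in> two_copies (V p)) \<and> w True c \<otimes>\<^bsub>T\<^esub> inv\<^bsub>T\<^esub> w False c = t \<and>
          (\<forall>l\<in>{1..k} \<times> UNIV - {c}. w True l = w False l)"
      if c: "c \<in> {1..k} \<times> UNIV" and t: "t \<in> carrier T" for c t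
    proof -
      obtain i d where i: "c = (i, d)" "i \<in> {1..k}" using c by auto
      obtain x y where xy: "x \<in> X" "y \<in> Y" "x i \<otimes>\<^bsub>T\<^esub> inv\<^bsub>T\<^esub> y i = t"
        "\<And>l. l \<in> {1..k} - {i} \<Longrightarrow> x l = y l"
        using factor[OF i(2) t] by blast
      \<comment> \<open>The chosen factorization in the copy that contains \<open>c\<close>, and \<open>1 = 1 \<cdot> 1\<close> in the other copy.\<close>
      define w where "w p l = (if snd l = d then if p then x (fst l) else y (fst l) else \<one>\<^bsub>?P\<^esub> (fst l))"
        for p l
      have "(\<lambda>l. w p (l, d')) \<in> V p" for p d'
        using xy(1,2) X.one_closed Y.one_closed
        by (cases p; cases "d' = d") (simp_all add: w_def V_def del: one_product_group)
      then have "\<forall>p. w p \<in> two_copies (V p)"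
        by (simp add: two_copies_def)
      moreover have "w True l = w False l" if "l \<in> {1..k} \<times> UNIV - {c}" for l
        using that xy(4)[of "fst l"] i by (cases l) (auto simp: w_def)
      ultimately show ?thesis
        using xy(3) i by (intro exI[of _ w]) (simp add: w_def)
    qed
  qed
  with assms(2) show False by blast
qed

end
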